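(* The formula $\Box\overline p\vee\Diamond(p\wedge\Box\overline p)$ (i.e. the Löb axiom $\Box(\Box p\to p)\to\Box p$) is absolutely minimal among all $\mathsf L_\Diamond$-formulas defining the class of transitive and converse well-founded frames.
   Context: Fix a countably infinite set of propositional variables $P$. $\mathsf L_\Diamond$ is the set of formulas in negation normal form built from literals $p,\overline p$ ($p\in P$), $\bot$ and $\top$ using $\vee,\wedge,\Diamond,\Box$; $\neg$ and $\to$ are abbreviations via De Morgan's rules. A frame is $(W,R)$ with $W$ nonempty and $R\subseteq W\times W$; it is converse well-founded if there is no infinite chain $w_0Rw_1Rw_2R\cdots$. A formula is valid on a frame if true at every point under every valuation (standard Kripke semantics). A formula $\varphi$ defines a class $\mathcal F$ of frames if for every frame $\mathcal A$, $\varphi$ is valid on $\mathcal A$ iff $\mathcal A\in\mathcal F$. The complexity measures considered are: the length (number of nodes of the syntax tree, leaves included); for each symbol among $\vee,\wedge,\Diamond,\Box,\bot,\top$, the number of its occurrences; the modal depth; and the number of distinct propositional variables. Given a set $\Gamma$ of formulas and $\varphi\in\Gamma$, $\varphi$ is absolutely minimal among $\Gamma$ if $\mu(\varphi)\leq\mu(\psi)$ for all $\psi\in\Gamma$ and every one of these measures $\mu$. *)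

theory Defs
  imports Main "HOL-Library.Countable_Set"
begin

datatype (vars: 'p) fm =
    Pos 'p
  | Neg 'p
  | is_Bot: Bot
  | is_Top: Top
  | is_Or: Or "'p fm" "'p fm"
  | is_And: And "'p fm" "'p fm"
  | is_Dia: Dia "'p fm"
  | is_Box: Box "'p fm"

type_synonym 'w frame = "'w set \<times> ('w \<times> 'w) set"

definition frames :: "'w frame set" where
  "frames = {(W, R). W \<noteq> {} \<and> R \<subseteq> W \<times> W}"

text \<open>The modal clauses need no restriction to \<open>W\<close>, since \<open>R \<subseteq> W \<times> W\<close> in every frame.\<close>

primrec sat :: "('w \<times> 'w) set \<Rightarrow> ('p \<Rightarrow> 'w set) \<Rightarrow> 'w \<Rightarrow> 'p fm \<Rightarrow> bool" where
  "sat R V w (Pos p) \<longleftrightarrow> w \<in> V p"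
| "sat R V w (Neg p) \<longleftrightarrow> w \<notin> V p"
| "sat R V w Bot \<longleftrightarrow> False"
| "sat R V w Top \<longleftrightarrow> True"
| "sat R V w (Or \<phi> \<psi>) \<longleftrightarrow> sat R V w \<phi> \<or> sat R V w \<psi>"
| "sat R V w (And \<phi> \<psi>) \<longleftrightarrow> sat R V w \<phi> \<and> sat R V w \<psi>"
| "sat R V w (Dia \<phi>) \<longleftrightarrow> (\<exists>v. (w, v) \<in> R \<and> sat R V v \<phi>)"
| "sat R V w (Box \<phi>) \<longleftrightarrow> (\<forall>v. (w, v) \<in> R \<longrightarrow> sat R V v \<phi>)"

text \<open>\<open>V\<close> ranges over all maps into subsets of the type of worlds; only its trace on \<open>W\<close>
  matters, so these are exactly the valuations on the frame.\<close>

definition valid :: "'w frame \<Rightarrow> 'p fm \<Rightarrow> bool" where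
  "valid A \<phi> \<longleftrightarrow> (\<forall>V. \<forall>w \<in> fst A. sat (snd A) V w \<phi>)"

definition defines_class :: "'p fm \<Rightarrow> 'w frame set \<Rightarrow> bool" where
  "defines_class \<phi> F \<longleftrightarrow> (\<forall>A \<in> frames. valid A \<phi> \<longleftrightarrow> A \<in> F)"

definition converse_wf :: "('w \<times> 'w) set \<Rightarrow> bool" where
  "converse_wf R \<longleftrightarrow> \<not> (\<exists>f :: nat \<Rightarrow> 'w. \<forall>i. (f i, f (Suc i)) \<in> R)"

definition trans_cwf_frames :: "'w frame set" where
  "trans_cwf_frames = {(W, R) \<in> frames. trans R \<and> converse_wf R}"

text \<open>The nodes of the syntax tree, each represented by the subformula rooted there; the same
  subformula is listed once for each of its occurrences.\<close>

primrec nodes :: "'p fm \<Rightarrow> 'p fm list" where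
  "nodes (Pos p) = [Pos p]"
| "nodes (Neg p) = [Neg p]"
| "nodes Bot = [Bot]"
| "nodes Top = [Top]"
| "nodes (Or \<phi> \<psi>) = Or \<phi> \<psi> # nodes \<phi> @ nodes \<psi>"
| "nodes (And \<phi> \<psi>) = And \<phi> \<psi> # nodes \<phi> @ nodes \<psi>"
| "nodes (Dia \<phi>) = Dia \<phi> # nodes \<phi>"
| "nodes (Box \<phi>) = Box \<phi> # nodes \<phi>"

definition fm_length :: "'p fm \<Rightarrow> nat" where
  "fm_length \<phi> = length (nodes \<phi>)"

definition occs :: "('p fm \<Rightarrow> bool) \<Rightarrow> 'p fm \<Rightarrow> nat" where
  "occs P \<phi> = length (filter P (nodes \<phi>))"

primrec modal_depth :: "'p fm \<Rightarrow> nat" where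
  "modal_depth (Pos p) = 0"
| "modal_depth (Neg p) = 0"
| "modal_depth Bot = 0"
| "modal_depth Top = 0"
| "modal_depth (Or \<phi> \<psi>) = max (modal_depth \<phi>) (modal_depth \<psi>)"
| "modal_depth (And \<phi> \<psi>) = max (modal_depth \<phi>) (modal_depth \<psi>)"
| "modal_depth (Dia \<phi>) = Suc (modal_depth \<phi>)"
| "modal_depth (Box \<phi>) = Suc (modal_depth \<phi>)"

definition num_vars :: "'p fm \<Rightarrow> nat" where
  "num_vars \<phi> = card (vars \<phi>)"

definition complexity_measures :: "('p fm \<Rightarrow> nat) set" where
  "complexity_measures =
    {fm_length, occs is_Or, occs is_And, occs is_Dia, occs is_Box, occs is_Bot, occs is_Top,
     modal_depth, num_vars}"

definition absolutely_minimal :: "'p fm \<Rightarrow> 'p fm set \<Rightarrow> bool" where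
  "absolutely_minimal \<phi> \<Gamma> \<longleftrightarrow>
    \<phi> \<in> \<Gamma> \<and> (\<forall>\<psi> \<in> \<Gamma>. \<forall>\<mu> \<in> complexity_measures. \<mu> \<phi> \<le> \<mu> \<psi>)"

definition loeb :: "'p \<Rightarrow> 'p fm" where
  "loeb p = Or (Box (Neg p)) (Dia (And (Pos p) (Box (Neg p))))"

primrec neg :: "'p fm \<Rightarrow> 'p fm" where
  "neg (Pos p) = Neg p"
| "neg (Neg p) = Pos p"
| "neg Bot = Top"
| "neg Top = Bot"
| "neg (Or \<phi> \<psi>) = And (neg \<phi>) (neg \<psi>)"
| "neg (And \<phi> \<psi>) = Or (neg \<phi>) (neg \<psi>)"
| "neg (Dia \<phi>) = Box (neg \<phi>)"
| "neg (Box \<phi>) = Dia (neg \<phi>)"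

definition imp :: "'p fm \<Rightarrow> 'p fm \<Rightarrow> 'p fm" where
  "imp \<phi> \<psi> = Or (neg \<phi>) \<psi>"

text \<open>The usual form of the Loeb axiom unfolds to \<open>loeb p\<close> with \<open>p\<close> and its negation exchanged
  and the arguments of the disjunction and of the conjunction swapped.\<close>

lemma loeb_axiom_unfold:
  "imp (Box (imp (Box (Pos p)) (Pos p))) (Box (Pos p))
    = Or (Dia (And (Box (Pos p)) (Neg p))) (Box (Pos p))"
  by (simp add: imp_def)

lemma valid_loeb_iff:
  "valid A (loeb p) \<longleftrightarrow> valid A (imp (Box (imp (Box (Pos p)) (Pos p))) (Box (Pos p)))"
  (is "?l \<longleftrightarrow> ?r")
proof
  assume l: ?l
  show ?r
    unfolding valid_def
  proof (intro allI ballI)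
    fix V w assume "w \<in> fst A"
    then have "sat (snd A) (\<lambda>q. - V q) w (loeb p)"
      using l unfolding valid_def by blast
    then show "sat (snd A) V w (imp (Box (imp (Box (Pos p)) (Pos p))) (Box (Pos p)))"
      by (auto simp: loeb_def imp_def)
  qed
next
  assume r: ?r
  show ?l
    unfolding valid_def
  proof (intro allI ballI)
    fix V w assume "w \<in> fst A"
    then have "sat (snd A) (\<lambda>q. - V q) w (imp (Box (imp (Box (Pos p)) (Pos p))) (Box (Pos p)))"
      using r unfolding valid_def by blast
    then show "sat (snd A) V w (loeb p)"
      by (auto simp: loeb_def imp_def)
  qed
qed

end

theory Submission imports Defs begin

text \<open>
  Each lower bound rests on a transfer: a formula that is valid on the class and contains too few
  occurrences of some symbol is also valid on a frame outside the class. Mostly it is enough that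
  the formula holds on the descending chain of order type \<open>\<omega>\<close>, in which every number sees exactly
  the smaller ones. Formulas without \<open>\<or>\<close>, or with at most one \<open>\<box>\<close>, transfer from it to a reflexive
  point. For formulas without \<open>\<and>\<close> the target is a reflexive point that also sees a dead end: \<open>0\<close>
  plays the dead end and the positive numbers are copies of the reflexive point. Removing edges
  disposes of formulas without \<open>\<diamond>\<close>, and a non-injective bounded morphism of those without variables.
  A formula of depth at most one cannot distinguish \<open>a \<rightarrow> b \<rightarrow> c\<close> from its transitive parts
  consisting of the edges from a single world. The length is determined by the numbers of connectives.
\<close>

section \<open>The class defined by the Loeb formula\<close>

lemma sat_loeb:
  "sat R V w (loeb p) \<longleftrightarrow>
    ((\<exists>v. (w, v) \<in> R \<and> v \<in> V p) \<longrightarrow>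
     (\<exists>v. (w, v) \<in> R \<and> v \<in> V p \<and> (\<forall>u. (v, u) \<in> R \<longrightarrow> u \<notin> V p)))"
  unfolding loeb_def by auto

lemma converse_wf_iff_wf: "converse_wf R \<longleftrightarrow> wf (R\<inverse>)"
  unfolding converse_wf_def wf_iff_no_infinite_down_chain by simp

lemma sat_loeb_trans_cwf:
  assumes "trans R" "converse_wf R"
  shows "sat R V w (loeb p)"
  unfolding sat_loeb
proof
  let ?S = "{v. (w, v) \<in> R \<and> v \<in> V p}"
  assume "\<exists>v. (w, v) \<in> R \<and> v \<in> V p"
  then obtain x where x: "x \<in> ?S" by blast
  have "wf (R\<inverse>)" using assms(2) by (simp add: converse_wf_iff_wf)
  \<comment> \<open>\<open>v\<close> is a last point of \<open>?S\<close>. By transitivity its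
    successors are successors of \<open>w\<close>, so one in \<open>V p\<close> would lie in
    \<open>?S\<close>.\<close>
  from wfE_min[OF this x] obtain v where v: "v \<in> ?S" "\<And>u. (u, v) \<in> R\<inverse> \<Longrightarrow> u \<notin> ?S"
    by blast
  then have "\<forall>u. (v, u) \<in> R \<longrightarrow> u \<notin> V p"
    using assms(1) by (auto dest: transD)
  with v(1) show "\<exists>v. (w, v) \<in> R \<and> v \<in> V p \<and> (\<forall>u. (v, u) \<in> R \<longrightarrow> u \<notin> V p)" by blast
qed

lemma trans_if_valid_loeb:
  assumes R: "R \<subseteq> W \<times> W" and valid: "valid (W, R) (loeb p)"
  shows "trans R"
proof (rule transI, rule ccontr)
  fix a b c assume ab: "(a, b) \<in> R" and bc: "(b, c) \<in> R" and ac: "(a, c) \<notin> R"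
  \<comment> \<open>Under this valuation \<open>b\<close> is the only successor of \<open>a\<close>
    satisfying \<open>p\<close>, and it sees \<open>c\<close>.\<close>
  have "sat R (\<lambda>_. {b, c}) a (loeb p)"
    using valid ab R unfolding valid_def by auto
  then show False
    using ab bc ac unfolding sat_loeb by auto
qed

lemma converse_wf_if_valid_loeb:
  assumes R: "R \<subseteq> W \<times> W" and valid: "valid (W, R) (loeb p)"
  shows "converse_wf R"
  unfolding converse_wf_def
proof
  assume "\<exists>f :: nat \<Rightarrow> _. \<forall>i. (f i, f (Suc i)) \<in> R"
  then obtain f :: "nat \<Rightarrow> _" where f: "\<And>i. (f i, f (Suc i)) \<in> R" by blast
  have "f 0 \<in> W" using f[of 0] R by blast
  \<comment> \<open>Every point of \<open>range f\<close> sees a point of \<open>range f\<close>, so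
    none is last.\<close>
  then have "sat R (\<lambda>_. range f) (f 0) (loeb p)"
    using valid unfolding valid_def by simp
  then show False
    using f unfolding sat_loeb by blast
qed

lemma defines_class_loeb: "defines_class (loeb p) trans_cwf_frames"
proof -
  have "valid (W, R) (loeb p) \<longleftrightarrow> trans R \<and> converse_wf R"
    if "(W, R) \<in> frames" for W R
    using that trans_if_valid_loeb[of R W p] converse_wf_if_valid_loeb[of R W p]
    by (auto simp: frames_def valid_def sat_loeb_trans_cwf)
  then show ?thesis
    unfolding defines_class_def trans_cwf_frames_def by auto
qed

section \<open>The descending chain\<close>

text \<open>The world type is only assumed to be infinite, so the chain is copied into it along
  \<open>g\<close>, later an injection.\<close>

definition chain :: "(nat \<Rightarrow> 'w) \<Rightarrow> ('w \<times> 'w) set" where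
  "chain g = {(g i, g j) | i j. j < i}"

lemma chain_iff: "inj g \<Longrightarrow> (g i, v) \<in> chain g \<longleftrightarrow> (\<exists>j<i. v = g j)"
  unfolding chain_def by (auto dest: injD)

lemma trans_chain:
  assumes "inj g"
  shows "trans (chain g)"
proof (rule transI)
  fix u v w assume "(u, v) \<in> chain g" "(v, w) \<in> chain g"
  then obtain i j k where "u = g i" "v = g j" "j < i" "w = g k" "k < j"
    unfolding chain_def using injD[OF assms] by blast
  then show "(u, w) \<in> chain g" unfolding chain_def using less_trans by blast
qed

lemma converse_wf_chain:
  assumes "inj g"
  shows "converse_wf (chain g)"
proof -
  have "(chain g)\<inverse> \<subseteq> measure (inv g)"
    using assms by (auto simp: chain_def)
  then show ?thesis
    unfolding converse_wf_iff_wf by (rule wf_subset[OF wf_measure])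
qed

lemma chain_in_trans_cwf_frames:
  "inj g \<Longrightarrow> (range g, chain g) \<in> trans_cwf_frames"
  unfolding trans_cwf_frames_def frames_def
  by (simp add: trans_chain converse_wf_chain) (auto simp: chain_def)

lemma sat_chain_Dia: "inj g \<Longrightarrow> sat (chain g) V (g i) (Dia \<phi>) \<longleftrightarrow> (\<exists>j<i. sat (chain g) V (g j) \<phi>)"
  by (auto simp: chain_iff)

lemma sat_chain_Box: "inj g \<Longrightarrow> sat (chain g) V (g i) (Box \<phi>) \<longleftrightarrow> (\<forall>j<i. sat (chain g) V (g j) \<phi>)"
  by (auto simp: chain_iff)

lemmas sat_chain_modal = sat_chain_Dia sat_chain_Box

text \<open>All bounds except that on the modal depth use the members of the class only through the
  chain.\<close>

lemma sat_chain_if_defines: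
  assumes "defines_class \<psi> (trans_cwf_frames :: 'w frame set)" "inj (g :: nat \<Rightarrow> 'w)"
  shows "sat (chain g) V (g i) \<psi>"
proof -
  have "(range g, chain g) \<in> trans_cwf_frames" by (rule chain_in_trans_cwf_frames[OF assms(2)])
  moreover from this have "(range g, chain g) \<in> frames" unfolding trans_cwf_frames_def by simp
  ultimately have "valid (range g, chain g) \<psi>" using assms(1) unfolding defines_class_def by blast
  then show ?thesis unfolding valid_def by simp
qed

lemma frame_refutes_if_defines:
  assumes "defines_class \<psi> (trans_cwf_frames :: 'w frame set)"
    and "(W :: 'w set) \<noteq> {}" "R \<subseteq> W \<times> W" "\<not> (trans R \<and> converse_wf R)"
  shows "\<exists>V. \<exists>w \<in> W. \<not> sat R V w \<psi>"
proof -
  have "(W, R) \<in> frames" using assms(2,3) unfolding frames_def by simp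
  moreover have "(W, R) \<notin> trans_cwf_frames" using assms(4) unfolding trans_cwf_frames_def by simp
  ultimately have "\<not> valid (W, R) \<psi>" using assms(1) unfolding defines_class_def by blast
  then show ?thesis unfolding valid_def by auto
qed

lemma not_converse_wf_if_reflexive: "(x, x) \<in> R \<Longrightarrow> \<not> converse_wf R"
  unfolding converse_wf_def by auto

section \<open>Occurrences of symbols\<close>

lemma occs_simps [simp]:
  "occs P (Pos q) = of_bool (P (Pos q))"
  "occs P (Neg q) = of_bool (P (Neg q))"
  "occs P Bot = of_bool (P Bot)"
  "occs P Top = of_bool (P Top)"
  "occs P (Or \<phi> \<psi>) = of_bool (P (Or \<phi> \<psi>)) + occs P \<phi> + occs P \<psi>"
  "occs P (And \<phi> \<psi>) = of_bool (P (And \<phi> \<psi>)) + occs P \<phi> + occs P \<psi>"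
  "occs P (Dia \<phi>) = of_bool (P (Dia \<phi>)) + occs P \<phi>"
  "occs P (Box \<phi>) = of_bool (P (Box \<phi>)) + occs P \<phi>"
  by (simp_all add: occs_def)

text \<open>A syntax tree has one more leaf than it has binary nodes.\<close>

lemma fm_length_eq:
  "fm_length \<phi> = 2 * (occs is_Or \<phi> + occs is_And \<phi>) + occs is_Dia \<phi> + occs is_Box \<phi> + 1"
  by (induction \<phi>) (simp_all add: fm_length_def)

section \<open>Disjunction\<close>

text \<open>Literals fail under some valuation, diamonds fail at \<open>g 0\<close>, and
  \<open>g (Suc i)\<close> sees \<open>g i\<close>. So validity descends through conjunctions and
  boxes and can only end in \<open>Top\<close>.\<close>

lemma Or_free_valid_chain:
  assumes "inj g" "occs is_Or \<phi> = 0" "\<And>V i. sat (chain g) V (g i) \<phi>"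
  shows "sat R U w \<phi>"
  using assms(2,3)
proof (induction \<phi> arbitrary: w)
  case (Pos q)
  from Pos.prems(2)[of "\<lambda>_. {}"] show ?case by simp
next
  case (Neg q)
  from Neg.prems(2)[of "\<lambda>_. UNIV"] show ?case by simp
next
  case (Dia \<phi>)
  from Dia.prems(2)[of _ 0] show ?case by (simp add: sat_chain_modal[OF assms(1)] del: sat.simps)
next
  case (Box \<phi>)
  have "sat (chain g) V (g i) \<phi>" for V i
    using Box.prems(2)[of V "Suc i"] by (simp add: sat_chain_modal[OF assms(1)] del: sat.simps)
  then show ?case using Box by simp
qed auto

lemma occs_Or_if_defines:
  assumes "defines_class \<psi> (trans_cwf_frames :: 'w frame set)" "inj (g :: nat \<Rightarrow> 'w)"
  shows "1 \<le> occs is_Or \<psi>"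
proof (rule ccontr)
  assume "\<not> ?thesis"
  then have Or_free: "occs is_Or \<psi> = 0" by simp
  fix x :: 'w
  have "\<not> converse_wf {(x, x)}" by (rule not_converse_wf_if_reflexive[of x]) simp
  then obtain V where "\<not> sat {(x, x)} V x \<psi>"
    using frame_refutes_if_defines[OF assms(1), of "{x}" "{(x, x)}"] by auto
  moreover have "sat {(x, x)} V x \<psi>"
    by (rule Or_free_valid_chain[OF assms(2) Or_free]) (rule sat_chain_if_defines[OF assms])
  ultimately show False by contradiction
qed

section \<open>Conjunction\<close>

text \<open>If an \<open>\<and>\<close>-free formula fails at the dead end, then none of its disjuncts is a \<open>\<box>\<close>. For such a
  formula failure at the reflexive point \<open>a\<close> carries over to every copy, hence below a \<open>\<diamond>\<close>, whose
  argument fails at \<open>a\<close> and \<open>b\<close>, all copies may be used.\<close>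

locale lollipop =
  fixes g :: "nat \<Rightarrow> 'w" and a b :: 'w and V :: "'p \<Rightarrow> 'w set"
  assumes inj: "inj g" and ab: "a \<noteq> b"
begin

abbreviation R :: "('w \<times> 'w) set" where "R \<equiv> {(a, a), (a, b)}"

definition V' :: "'p \<Rightarrow> 'w set" where
  "V' q = {g i | i. (if i = 0 then b else a) \<in> V q}"

lemma in_V' [simp]: "g i \<in> V' q \<longleftrightarrow> (if i = 0 then b else a) \<in> V q"
  unfolding V'_def using inj by (simp only: mem_Collect_eq inj_eq) blast

lemma sat_dead_end: "sat (chain g) V' (g 0) \<phi> \<longleftrightarrow> sat R V b \<phi>"
  using ab by (induction \<phi>) (simp_all add: sat_chain_modal[OF inj] del: sat.simps(7,8), simp_all)

lemma refuted_at_all_copies: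
  assumes "occs is_And \<phi> = 0" "\<not> sat R V a \<phi>" "\<not> sat R V b \<phi>"
  shows "\<not> sat (chain g) V' (g i) \<phi>"
  using assms
proof (induction \<phi> arbitrary: i)
  case (Dia \<phi>)
  then show ?case by (auto simp: sat_chain_modal[OF inj] simp del: sat.simps(7) dest: spec) (auto)
next
  case (Box \<phi>)
  \<comment> \<open>No box fails at the dead end \<open>b\<close>.\<close>
  then show ?case using ab by auto
qed auto

text \<open>A box refuted via \<open>a\<close> costs one step down the chain. The bound on the depth
  keeps these steps at positive indices, the copies of \<open>a\<close>.\<close>

lemma refuted_at_high_copies:
  assumes "occs is_And \<phi> = 0" "\<not> sat R V a \<phi>" "modal_depth \<phi> < i"
  shows "\<not> sat (chain g) V' (g i) \<phi>"
  using assms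
proof (induction \<phi> arbitrary: i)
  case (Dia \<phi>)
  then have "\<not> sat (chain g) V' (g j) \<phi>" for j
    by (intro refuted_at_all_copies) auto
  then show ?case by (simp add: sat_chain_modal[OF inj] del: sat.simps)
next
  case (Box \<phi>)
  from Box.prems(2) consider "\<not> sat R V a \<phi>" | "\<not> sat R V b \<phi>" by auto
  then show ?case
  proof cases
    case 1
    then have "\<not> sat (chain g) V' (g (i - 1)) \<phi>"
      using Box by simp
    moreover have "i - 1 < i" using Box.prems by simp
    ultimately show ?thesis unfolding sat_chain_Box[OF inj] by blast
  next
    case 2
    then have "\<not> sat (chain g) V' (g 0) \<phi>" by (simp add: sat_dead_end)
    moreover have "0 < i" using Box.prems by simp
    ultimately show ?thesis unfolding sat_chain_Box[OF inj] by blast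
  qed
qed auto

end

lemma occs_And_if_defines:
  assumes "defines_class \<psi> (trans_cwf_frames :: 'w frame set)" "inj (g :: nat \<Rightarrow> 'w)"
  shows "1 \<le> occs is_And \<psi>"
proof (rule ccontr)
  assume And_free: "\<not> ?thesis"
  have "g 0 \<noteq> g 1" using assms(2) by (simp add: inj_eq)
  then obtain a b :: 'w where ab: "a \<noteq> b" by blast
  have "\<not> converse_wf {(a, a), (a, b)}" by (rule not_converse_wf_if_reflexive[of a]) simp
  then obtain V w where w: "w \<in> {a, b}" "\<not> sat {(a, a), (a, b)} V w \<psi>"
    using frame_refutes_if_defines[OF assms(1), of "{a, b}" "{(a, a), (a, b)}"] by auto
  interpret lollipop g a b V using assms(2) ab by unfold_locales
  have "\<exists>i. \<not> sat (chain g) V' (g i) \<psi>"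
  proof (cases "w = b")
    case True
    then show ?thesis using w sat_dead_end by blast
  next
    case False
    then show ?thesis
      using w And_free refuted_at_high_copies[of \<psi> "Suc (modal_depth \<psi>)"] by auto
  qed
  then show False using sat_chain_if_defines[OF assms] by blast
qed

section \<open>Box and diamond\<close>

text \<open>All points of the chain carry the literals of \<open>x\<close>, and the loop at
  \<open>x\<close> witnesses every diamond.\<close>

lemma sat_reflexive_point_if_Box_free:
  assumes "inj g" "occs is_Box \<phi> = 0" "sat (chain g) (\<lambda>q. if x \<in> V q then UNIV else {}) (g i) \<phi>"
  shows "sat {(x, x)} V x \<phi>"
  using assms(2,3)
  by (induction \<phi> arbitrary: i)
    (auto simp: sat_chain_modal[OF assms(1)] simp del: sat.simps(7,8) split: if_splits, auto)

text \<open>\<open>g 0\<close> rules out diamonds, and \<open>g 1\<close> forces the argument of a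
  box to hold at \<open>g 0\<close>. Of two disjuncts one is box-free: either it holds at one of
  these points, or the other disjunct holds at both.\<close>

lemma sat_reflexive_point_if_one_Box:
  assumes "inj g" "occs is_Box \<phi> \<le> 1" "sat (chain g) (\<lambda>q. if x \<in> V q then UNIV else {}) (g 0) \<phi>" "sat (chain g) (\<lambda>q. if x \<in> V q then UNIV else {}) (g 1) \<phi>"
  shows "sat {(x, x)} V x \<phi>"
  using assms(2-4)
proof (induction \<phi>)
  case (Or \<phi> \<psi>)
  have "occs is_Box \<phi> = 0 \<or> occs is_Box \<psi> = 0" using Or.prems by auto
  moreover have "sat {(x, x)} V x \<chi>"
    if "occs is_Box \<chi> = 0" "sat (chain g) (\<lambda>q. if x \<in> V q then UNIV else {}) (g i) \<chi>" for \<chi> i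
    using sat_reflexive_point_if_Box_free[OF assms(1) that] .
  ultimately show ?case using Or by simp metis
next
  case (Dia \<phi>)
  then show ?case by (simp add: sat_chain_modal[OF assms(1)] del: sat.simps)
next
  case (Box \<phi>)
  then have "sat (chain g) (\<lambda>q. if x \<in> V q then UNIV else {}) (g 0) \<phi>"
    by (simp add: sat_chain_modal[OF assms(1)] del: sat.simps)
  then have "sat {(x, x)} V x \<phi>"
    using Box sat_reflexive_point_if_Box_free[OF assms(1)] by simp
  then show ?case by simp
qed (simp_all split: if_splits)

lemma occs_Box_if_defines:
  assumes "defines_class \<psi> (trans_cwf_frames :: 'w frame set)" "inj (g :: nat \<Rightarrow> 'w)"
  shows "2 \<le> occs is_Box \<psi>"
proof (rule ccontr)
  assume few: "\<not> ?thesis"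
  fix x :: 'w
  have "\<not> converse_wf {(x, x)}" by (rule not_converse_wf_if_reflexive[of x]) simp
  then obtain V where "\<not> sat {(x, x)} V x \<psi>"
    using frame_refutes_if_defines[OF assms(1), of "{x}" "{(x, x)}"] by auto
  moreover have "sat {(x, x)} V x \<psi>"
    using few sat_chain_if_defines[OF assms]
    by (intro sat_reflexive_point_if_one_Box[OF assms(2)]) auto
  ultimately show False by contradiction
qed

lemma sat_antimono_if_Dia_free:
  assumes "R' \<subseteq> R" "occs is_Dia \<phi> = 0" "sat R V w \<phi>"
  shows "sat R' V w \<phi>"
  using assms(2,3) by (induction \<phi> arbitrary: w) (use assms(1) in auto)

lemma occs_Dia_if_defines:
  assumes "defines_class \<psi> (trans_cwf_frames :: 'w frame set)" "inj (g :: nat \<Rightarrow> 'w)"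
  shows "1 \<le> occs is_Dia \<psi>"
proof (rule ccontr)
  assume few: "\<not> ?thesis"
  let ?R = "{(g 2, g 1), (g 1, g 0)}"
  \<comment> \<open>Deleting the edge from \<open>g 2\<close> to \<open>g 0\<close> destroys
    transitivity.\<close>
  have sub: "?R \<subseteq> chain g" unfolding chain_def by fastforce
  have "\<not> trans ?R"
    using assms(2) by (auto simp: trans_def inj_eq)
  then obtain V i where "\<not> sat ?R V (g i) \<psi>"
    using frame_refutes_if_defines[OF assms(1), of "range g" ?R] by auto
  moreover have "sat ?R V (g i) \<psi>"
    using few by (intro sat_antimono_if_Dia_free[OF sub _ sat_chain_if_defines[OF assms]]) simp
  ultimately show False by contradiction
qed

section \<open>Modal depth and variables\<close>

lemma sat_depth_0: "modal_depth \<phi> = 0 \<Longrightarrow> sat R V w \<phi> \<longleftrightarrow> sat R' V w \<phi>"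
  by (induction \<phi>) auto

text \<open>Arguments of modal operators have depth 0 here, so only edges leaving \<open>w\<close>
  matter.\<close>

lemma sat_depth_1:
  "modal_depth \<phi> \<le> 1 \<Longrightarrow> sat (R \<inter> {w} \<times> UNIV) V w \<phi> \<longleftrightarrow> sat R V w \<phi>"
  by (induction \<phi>) (auto simp: sat_depth_0[of _ "R \<inter> {w} \<times> UNIV" V _ R])

lemma modal_depth_if_defines:
  assumes "defines_class \<psi> (trans_cwf_frames :: 'w frame set)" "inj (g :: nat \<Rightarrow> 'w)"
  shows "2 \<le> modal_depth \<psi>"
proof (rule ccontr)
  assume few: "\<not> ?thesis"
  let ?R = "{(g 2, g 1), (g 1, g 0)}"
  have "\<not> trans ?R"
    using assms(2) by (auto simp: trans_def inj_eq)
  then obtain V w where w: "w \<in> range g" "\<not> sat ?R V w \<psi>"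
    using frame_refutes_if_defines[OF assms(1), of "range g" ?R] by auto
  let ?S = "?R \<inter> {w} \<times> UNIV"
  \<comment> \<open>All edges of \<open>?S\<close> start at \<open>w\<close> and none is a loop, so
    no two edges compose.\<close>
  have ne: "v \<noteq> w" if "(w, v) \<in> ?R" for v
    using that assms(2) by (auto simp: inj_eq)
  have "trans ?S" using ne unfolding trans_def by blast
  moreover have "converse_wf ?S"
    unfolding converse_wf_def
  proof
    assume "\<exists>f :: nat \<Rightarrow> 'w. \<forall>i. (f i, f (Suc i)) \<in> ?S"
    then obtain f :: "nat \<Rightarrow> 'w" where "(f 0, f 1) \<in> ?S" "(f 1, f 2) \<in> ?S"
      by (metis One_nat_def Suc_1)
    then show False using ne by blast
  qed
  ultimately have "(range g, ?S) \<in> trans_cwf_frames"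
    unfolding trans_cwf_frames_def frames_def by auto
  then have "sat ?S V w \<psi>"
    using assms(1) w(1) unfolding defines_class_def trans_cwf_frames_def valid_def by auto
  then show False using w(2) few sat_depth_1[of \<psi> ?R w V] by simp
qed

lemma sat_bounded_morphism_if_var_free:
  assumes step: "\<And>v w. (v, w) \<in> R \<Longrightarrow> (h v, h w) \<in> S"
    and lift: "\<And>v w'. (h v, w') \<in> S \<Longrightarrow> \<exists>w. (v, w) \<in> R \<and> h w = w'"
    and "vars \<phi> = {}"
  shows "sat R V v \<phi> \<longleftrightarrow> sat S U (h v) \<phi>"
  using assms(3)
proof (induction \<phi> arbitrary: v)
  case (Dia \<phi>)
  then show ?case using step lift by simp blast
next
  case (Box \<phi>)
  then show ?case using step lift by simp blast
qed auto

lemma vars_if_defines: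
  assumes "defines_class \<psi> (trans_cwf_frames :: 'w frame set)" "inj (g :: nat \<Rightarrow> 'w)"
  shows "vars \<psi> \<noteq> {}"
proof
  assume var_free: "vars \<psi> = {}"
  \<comment> \<open>The missing edge from \<open>g 3\<close> to \<open>g 0\<close> is replaced by
    one to a second dead end \<open>g 2\<close>, which \<open>h\<close> identifies with
    \<open>g 0\<close>; \<open>h\<close> maps \<open>g 3\<close> to the point \<open>g 2\<close> of
    the chain.\<close>
  let ?R = "{(g 3, g 1), (g 1, g 0), (g 3, g 2)}"
  define h where "h v = (if v = g 3 then g 2 else if v = g 1 then g 1 else g 0)" for v
  note g_eq = inj_eq[OF assms(2)]
  have chain_2: "(g 2, w) \<in> chain g \<longleftrightarrow> w = g 0 \<or> w = g 1"
    and chain_1: "(g 1, w) \<in> chain g \<longleftrightarrow> w = g 0"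
    and chain_0: "(g 0, w) \<notin> chain g" for w
    by (auto simp: chain_iff[OF assms(2)] less_2_cases_iff)
  have "\<not> trans ?R"
    unfolding trans_def by (auto simp: g_eq)
  then obtain V i where "\<not> sat ?R V (g i) \<psi>"
    using frame_refutes_if_defines[OF assms(1), of "range g" ?R] by auto
  moreover have "sat ?R V (g i) \<psi> \<longleftrightarrow> sat (chain g) V (h (g i)) \<psi>"
  proof (rule sat_bounded_morphism_if_var_free[OF _ _ var_free])
    show "(h v, h w) \<in> chain g" if "(v, w) \<in> ?R" for v w
      using that by (auto simp: h_def g_eq chain_2 chain_1[simplified])
    show "\<exists>w. (v, w) \<in> ?R \<and> h w = w'" if "(h v, w') \<in> chain g" for v w'
    proof -
      have "v = g 3 \<and> w' = g 0 \<or> v = g 3 \<and> w' = g 1 \<or> v = g 1 \<and> w' = g 0"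
        using that by (auto simp: h_def chain_2 chain_1[simplified] chain_0 split: if_splits)
      moreover have "h (g 0) = g 0" "h (g 1) = g 1" "h (g 2) = g 0"
        by (simp_all add: h_def g_eq)
      ultimately show ?thesis by blast
    qed
  qed
  ultimately show False
    using sat_chain_if_defines[OF assms] by (auto simp: h_def split: if_splits)
qed

lemma num_vars_if_defines:
  assumes "defines_class \<psi> (trans_cwf_frames :: 'w frame set)" "inj (g :: nat \<Rightarrow> 'w)"
  shows "1 \<le> num_vars \<psi>"
proof -
  have "finite (vars \<psi>)" by (induction \<psi>) auto
  then show ?thesis
    using vars_if_defines[OF assms] by (simp add: num_vars_def Suc_le_eq card_gt_0_iff)
qed

theorem theorem8p1:
  fixes p :: 'p
  assumes "countable (UNIV :: 'p set)" and "infinite (UNIV :: 'p set)"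
    and "infinite (UNIV :: 'w set)"
  shows "absolutely_minimal (loeb p) {\<psi>. defines_class \<psi> (trans_cwf_frames :: 'w frame set)}"
proof -
  obtain g :: "nat \<Rightarrow> 'w" where g: "inj g"
    using infinite_countable_subset[OF assms(3)] by blast
  have "\<mu> (loeb p) \<le> \<mu> \<psi>"
    if \<psi>: "defines_class \<psi> (trans_cwf_frames :: 'w frame set)" and \<mu>: "\<mu> \<in> complexity_measures"
    for \<psi> and \<mu> :: "'p fm \<Rightarrow> nat"
  proof -
    note bounds = occs_Or_if_defines[OF \<psi> g] occs_And_if_defines[OF \<psi> g]
      occs_Dia_if_defines[OF \<psi> g] occs_Box_if_defines[OF \<psi> g]
      modal_depth_if_defines[OF \<psi> g] num_vars_if_defines[OF \<psi> g]
    have "fm_length (loeb p) \<le> fm_length \<psi>"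
      using bounds(1-4) unfolding fm_length_eq by (simp add: loeb_def)
    with \<mu> bounds show ?thesis
      unfolding complexity_measures_def by (elim insertE emptyE) (simp_all add: loeb_def num_vars_def)
  qed
  then show ?thesis
    by (simp add: absolutely_minimal_def defines_class_loeb)
qed

end
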